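(* Let $\mathbb{F}_q$ be the finite field with $q$ elements and let $m \in \mathbb{F}_q[x]$ be a monic irreducible polynomial of degree at most $2$. Let $\mathcal{C}(m)$ be the set of matrices in $M_2(\mathbb{F}_q)$ whose minimal polynomial is $m$. (1) If $m$ is linear, then $\mathcal{C}(m)$ contains exactly $2$ core subsets. (2) If $m$ is quadratic, then $\mathcal{C}(m)$ contains exactly $q^2-q$ noncore subsets.
   Context: $M_2(\mathbb{F}_q)$ is the ring of $2\times 2$ matrices over $\mathbb{F}_q$. In the polynomial ring $M_2(\mathbb{F}_q)[x]$ the variable $x$ commutes with all coefficients, and polynomials are evaluated from the right: for $f=\sum_i \alpha_i x^i$ with $\alpha_i\in M_2(\mathbb{F}_q)$ and $A\in M_2(\mathbb{F}_q)$, $f(A)=\sum_i \alpha_i A^i$. For $S\subseteq M_2(\mathbb{F}_q)$, the null ideal of $S$ is $N(S)=\{f\in M_2(\mathbb{F}_q)[x] \mid f(A)=0 \text{ for all } A\in S\}$; it is always a left ideal of $M_2(\mathbb{F}_q)[x]$. The set $S$ is called core if $N(S)$ is a two-sided ideal of $M_2(\mathbb{F}_q)[x]$, and noncore otherwise. The empty set is core. *)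

theory Defs
  imports
    "Jordan_Normal_Form.Matrix"
    "HOL-Algebra.UnivPoly"
    "HOL-Computational_Algebra.Polynomial_Factorial"
    "HOL-Library.Cardinality"
begin

text \<open>
  The field with \<open>q\<close> elements is a type \<open>'a\<close> of sort \<open>{field, finite}\<close>, with \<open>q = CARD('a)\<close>.
\<close>

abbreviation M2 :: "'a::field mat ring" where
  "M2 \<equiv> ring_mat TYPE('a) 2 ()"

text \<open>
  The construction \<^const>\<open>UP\<close> does not need a commutative coefficient ring: its product is the
  convolution \<open>(\<Sum>i\<le>n. p i \<otimes> q (n - i))\<close>, with the factors in this order, so the variable
  commutes with all coefficients.
\<close>

abbreviation M2x :: "('a::field mat, nat \<Rightarrow> 'a mat) up_ring" where
  "M2x \<equiv> UP M2"

text \<open>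
  Evaluation from the right. The library's \<open>eval\<close> yields
  \<open>\<Oplus>i \<in> {..deg f}. \<alpha>\<^sub>i \<otimes> A [^] i\<close>, with the coefficients on the left of the powers; this is in general
  not a ring homomorphism in \<open>f\<close>.
\<close>

definition reval :: "(nat \<Rightarrow> 'a::field mat) \<Rightarrow> 'a mat \<Rightarrow> 'a mat" where
  "reval f A = eval M2 M2 (\<lambda>\<alpha>. \<alpha>) A f"

definition null_ideal :: "'a::field mat set \<Rightarrow> (nat \<Rightarrow> 'a mat) set" where
  "null_ideal S = {f \<in> carrier M2x. \<forall>A\<in>S. reval f A = \<zero>\<^bsub>M2\<^esub>}"

text \<open>The locale \<^locale>\<open>ideal\<close> requires closure under multiplication from both sides.\<close>

definition core :: "'a::field mat set \<Rightarrow> bool" where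
  "core S \<longleftrightarrow> ideal (null_ideal S) M2x"

abbreviation noncore :: "'a::field mat set \<Rightarrow> bool" where
  "noncore S \<equiv> \<not> core S"

definition poly_at_mat :: "'a::field poly \<Rightarrow> 'a mat \<Rightarrow> 'a mat" where
  "poly_at_mat p A = (\<Oplus>\<^bsub>M2\<^esub>i\<in>{..degree p}. poly.coeff p i \<cdot>\<^sub>m (A [^]\<^bsub>M2\<^esub> i))"

definition is_min_poly :: "'a::field mat \<Rightarrow> 'a poly \<Rightarrow> bool" where
  "is_min_poly A p \<longleftrightarrow>
     lead_coeff p = 1 \<and> poly_at_mat p A = \<zero>\<^bsub>M2\<^esub> \<and>
     (\<forall>f. f \<noteq> 0 \<and> poly_at_mat f A = \<zero>\<^bsub>M2\<^esub> \<longrightarrow> degree p \<le> degree f)"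

definition min_poly_class :: "'a::field poly \<Rightarrow> 'a mat set" where
  "min_poly_class m = {A \<in> carrier M2. is_min_poly A m}"

end

theory Submission
  imports Defs
begin

text \<open>
  A scalar matrix is central, so evaluation at it has a two-sided kernel. Now let \<open>m\<close> be an
  irreducible quadratic. The null ideal of \<open>{A}\<close> contains \<open>x - A\<close>, hence is two-sided only if \<open>A\<close>
  is central, which no element of the class of \<open>m\<close> is. If \<open>A \<noteq> B\<close> lie in the class, then \<open>A - B\<close> is
  invertible, because \<open>m\<close> has no root. Modulo \<open>m\<close> every polynomial is some \<open>\<alpha> x + \<beta>\<close>, and vanishing
  at \<open>A\<close> and \<open>B\<close> forces \<open>\<alpha> = \<beta> = 0\<close>; the null ideal is then generated by the central element \<open>m\<close>.
  So the noncore subsets are exactly the singletons, and the class consists of the matrices with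
  \<open>b \<noteq> 0\<close> in the upper right corner and arbitrary upper left corner, the other two entries being
  determined by trace and determinant.
\<close>

section \<open>Weighted coefficient sums of polynomials over a noncommutative ring\<close>

context UP_ring
begin

text \<open>The weights \<open>A^i\<close> give evaluation at \<open>A\<close> from the right; other
  weights will give the coefficients of a remainder.\<close>

definition weighted_sum :: "(nat \<Rightarrow> 'a) \<Rightarrow> (nat \<Rightarrow> 'a) \<Rightarrow> 'a" where
  "weighted_sum w f = (\<Oplus>i\<in>{..deg R f}. up_ring.coeff P f i \<otimes> w i)"

context
  fixes w :: "nat \<Rightarrow> 'a"
  assumes w: "w \<in> UNIV \<rightarrow> carrier R"
begin

lemma w_closed [simp]: "w i \<in> carrier R"
  using w by auto

lemma weighted_sum_bound:
  assumes "f \<in> carrier P" "deg R f \<le> n"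
  shows "weighted_sum w f = (\<Oplus>i\<in>{..n}. up_ring.coeff P f i \<otimes> w i)"
  unfolding weighted_sum_def
  by (rule R.add.finprod_mono_neutral_cong_left)
    (use assms in \<open>auto simp: deg_aboveD\<close>)

lemma weighted_sum_closed [simp]:
  "f \<in> carrier P \<Longrightarrow> weighted_sum w f \<in> carrier R"
  unfolding weighted_sum_def by (intro R.finsum_closed) auto

lemma weighted_sum_add:
  assumes "f \<in> carrier P" "g \<in> carrier P"
  shows "weighted_sum w (f \<oplus>\<^bsub>P\<^esub> g) = weighted_sum w f \<oplus> weighted_sum w g"
proof -
  let ?n = "max (deg R f) (deg R g)"
  have "weighted_sum w (f \<oplus>\<^bsub>P\<^esub> g) = (\<Oplus>i\<in>{..?n}. up_ring.coeff P (f \<oplus>\<^bsub>P\<^esub> g) i \<otimes> w i)"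
    using assms by (intro weighted_sum_bound) auto
  also have "\<dots> = (\<Oplus>i\<in>{..?n}. up_ring.coeff P f i \<otimes> w i \<oplus> up_ring.coeff P g i \<otimes> w i)"
    using assms by (intro R.finsum_cong') (auto simp: R.l_distr)
  also have "\<dots> = (\<Oplus>i\<in>{..?n}. up_ring.coeff P f i \<otimes> w i) \<oplus> (\<Oplus>i\<in>{..?n}. up_ring.coeff P g i \<otimes> w i)"
    using assms by (intro R.finsum_addf) auto
  also have "\<dots> = weighted_sum w f \<oplus> weighted_sum w g"
    using assms by (simp add: weighted_sum_bound[of _ ?n])
  finally show ?thesis .
qed

lemma weighted_sum_zero: "weighted_sum w \<zero>\<^bsub>P\<^esub> = \<zero>"
  by (simp add: weighted_sum_def)

lemma weighted_sum_finsum: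
  assumes "finite I" "F \<in> I \<rightarrow> carrier P"
  shows "weighted_sum w (\<Oplus>\<^bsub>P\<^esub>i\<in>I. F i) = (\<Oplus>i\<in>I. weighted_sum w (F i))"
  using assms
proof (induction rule: finite_induct)
  case (insert i I)
  then have F: "F i \<in> carrier P" "F \<in> I \<rightarrow> carrier P"
    by auto
  then have "(\<lambda>j. weighted_sum w (F j)) \<in> I \<rightarrow> carrier R"
    by (auto simp: Pi_iff)
  with insert F show ?case
    by (simp add: weighted_sum_add)
qed (simp add: weighted_sum_zero)

lemma weighted_sum_monom:
  assumes "c \<in> carrier R"
  shows "weighted_sum w (up_ring.monom P c n) = c \<otimes> w n"
proof -
  have "weighted_sum w (up_ring.monom P c n) = (\<Oplus>i\<in>{..n}. up_ring.coeff P (up_ring.monom P c n) i \<otimes> w i)"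
    using assms by (intro weighted_sum_bound) (auto simp: deg_monom_le)
  also have "\<dots> = (\<Oplus>i\<in>{..n}. if n = i then c \<otimes> w i else \<zero>)"
    using assms by (intro R.finsum_cong') auto
  also have "\<dots> = c \<otimes> w n"
    using assms by (subst R.finsum_singleton) auto
  finally show ?thesis .
qed

text \<open>The constant \<open>c\<close> ends up between coefficient and weight and in general
  cannot be pulled out of the sum, which is why a null ideal may fail to be two-sided.\<close>

lemma weighted_sum_mult_monom:
  assumes "f \<in> carrier P" "c \<in> carrier R"
  shows "weighted_sum w (f \<otimes>\<^bsub>P\<^esub> up_ring.monom P c n)
    = (\<Oplus>i\<in>{..deg R f}. up_ring.coeff P f i \<otimes> c \<otimes> w (i + n))"
proof -
  have "f \<otimes>\<^bsub>P\<^esub> up_ring.monom P c n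
      = (\<Oplus>\<^bsub>P\<^esub>i\<in>{..deg R f}. up_ring.monom P (up_ring.coeff P f i) i) \<otimes>\<^bsub>P\<^esub> up_ring.monom P c n"
    using assms by (simp add: up_repr)
  also have "\<dots> = (\<Oplus>\<^bsub>P\<^esub>i\<in>{..deg R f}. up_ring.monom P (up_ring.coeff P f i) i \<otimes>\<^bsub>P\<^esub> up_ring.monom P c n)"
    using assms by (intro P.finsum_ldistr) auto
  also have "\<dots> = (\<Oplus>\<^bsub>P\<^esub>i\<in>{..deg R f}. up_ring.monom P (up_ring.coeff P f i \<otimes> c) (i + n))"
    using assms by (intro P.finsum_cong') auto
  finally have "weighted_sum w (f \<otimes>\<^bsub>P\<^esub> up_ring.monom P c n)
      = weighted_sum w (\<Oplus>\<^bsub>P\<^esub>i\<in>{..deg R f}. up_ring.monom P (up_ring.coeff P f i \<otimes> c) (i + n))"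
    by simp
  also have "\<dots> = (\<Oplus>i\<in>{..deg R f}. weighted_sum w (up_ring.monom P (up_ring.coeff P f i \<otimes> c) (i + n)))"
    using assms by (intro weighted_sum_finsum) auto
  \<comment> \<open>As a rewrite rule \<open>monom_mult\<close> would split the monomial into a
    product and keep \<open>weighted_sum_monom\<close> from applying.\<close>
  also have "\<dots> = (\<Oplus>i\<in>{..deg R f}. up_ring.coeff P f i \<otimes> c \<otimes> w (i + n))"
    using assms by (intro R.finsum_cong') (auto simp: weighted_sum_monom simp del: monom_mult)
  finally show ?thesis .
qed

text \<open>Here \<open>c\<close> stands leftmost in every term, so nothing has to commute with the
  weights.\<close>

lemma weighted_sum_monom_mult:
  assumes "f \<in> carrier P" "c \<in> carrier R"
  shows "weighted_sum w (up_ring.monom P c n \<otimes>\<^bsub>P\<^esub> f)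
    = (\<Oplus>i\<in>{..deg R f}. c \<otimes> up_ring.coeff P f i \<otimes> w (n + i))"
proof -
  have "up_ring.monom P c n \<otimes>\<^bsub>P\<^esub> f
      = up_ring.monom P c n \<otimes>\<^bsub>P\<^esub> (\<Oplus>\<^bsub>P\<^esub>i\<in>{..deg R f}. up_ring.monom P (up_ring.coeff P f i) i)"
    using assms by (simp add: up_repr)
  also have "\<dots> = (\<Oplus>\<^bsub>P\<^esub>i\<in>{..deg R f}. up_ring.monom P c n \<otimes>\<^bsub>P\<^esub> up_ring.monom P (up_ring.coeff P f i) i)"
    using assms by (intro P.finsum_rdistr) auto
  also have "\<dots> = (\<Oplus>\<^bsub>P\<^esub>i\<in>{..deg R f}. up_ring.monom P (c \<otimes> up_ring.coeff P f i) (n + i))"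
    using assms by (intro P.finsum_cong') auto
  finally have "weighted_sum w (up_ring.monom P c n \<otimes>\<^bsub>P\<^esub> f)
      = weighted_sum w (\<Oplus>\<^bsub>P\<^esub>i\<in>{..deg R f}. up_ring.monom P (c \<otimes> up_ring.coeff P f i) (n + i))"
    by simp
  also have "\<dots> = (\<Oplus>i\<in>{..deg R f}. weighted_sum w (up_ring.monom P (c \<otimes> up_ring.coeff P f i) (n + i)))"
    using assms by (intro weighted_sum_finsum) auto
  also have "\<dots> = (\<Oplus>i\<in>{..deg R f}. c \<otimes> up_ring.coeff P f i \<otimes> w (n + i))"
    using assms by (intro R.finsum_cong') (auto simp: weighted_sum_monom simp del: monom_mult)
  finally show ?thesis .
qed

end

section \<open>Null ideals and central elements\<close>

text \<open>The word "right" refers to the side of evaluation; the set is a left ideal.\<close>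

definition right_null_ideal :: "'a set \<Rightarrow> (nat \<Rightarrow> 'a) set" where
  "right_null_ideal S = {f \<in> carrier P. \<forall>A\<in>S. weighted_sum (\<lambda>i. A [^] i) f = \<zero>}"

definition central :: "'a \<Rightarrow> bool" where
  "central z \<longleftrightarrow> z \<in> carrier R \<and> (\<forall>x\<in>carrier R. z \<otimes> x = x \<otimes> z)"

lemma central_zero: "central \<zero>"
  by (simp add: central_def)

lemma central_one: "central \<one>"
  by (simp add: central_def)

lemma central_add: "central x \<Longrightarrow> central y \<Longrightarrow> central (x \<oplus> y)"
  by (simp add: central_def R.l_distr R.r_distr)

lemma central_mult: "central x \<Longrightarrow> central y \<Longrightarrow> central (x \<otimes> y)"
  unfolding central_def by (metis R.m_assoc R.m_closed)

lemma central_pow: "central x \<Longrightarrow> central (x [^] (n::nat))"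
  by (induction n) (auto simp: central_one central_mult)

lemma central_closed [simp]: "central x \<Longrightarrow> x \<in> carrier R"
  by (simp add: central_def)

lemma subgroup_right_null_ideal:
  assumes "S \<subseteq> carrier R"
  shows "subgroup (right_null_ideal S) (add_monoid P)"
proof (rule P.add.subgroupI)
  have pow: "(\<lambda>i. A [^] (i::nat)) \<in> UNIV \<rightarrow> carrier R" if "A \<in> S" for A
    using assms that by auto
  show "right_null_ideal S \<subseteq> carrier P"
    by (auto simp: right_null_ideal_def)
  have "\<zero>\<^bsub>P\<^esub> \<in> right_null_ideal S"
    using pow by (simp add: right_null_ideal_def weighted_sum_zero)
  then show "right_null_ideal S \<noteq> {}"
    by auto
  show "f \<oplus>\<^bsub>P\<^esub> g \<in> right_null_ideal S"
    if "f \<in> right_null_ideal S" "g \<in> right_null_ideal S" for f g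
    using that pow by (simp add: right_null_ideal_def weighted_sum_add)
  show "\<ominus>\<^bsub>P\<^esub> f \<in> right_null_ideal S" if f: "f \<in> right_null_ideal S" for f
  proof -
    have "weighted_sum (\<lambda>i. A [^] i) (\<ominus>\<^bsub>P\<^esub> f) = \<zero>" if "A \<in> S" for A
    proof -
      have "weighted_sum (\<lambda>i. A [^] i) (f \<oplus>\<^bsub>P\<^esub> \<ominus>\<^bsub>P\<^esub> f) = \<zero>"
        using f pow[OF that] by (simp add: right_null_ideal_def P.r_neg weighted_sum_zero)
      moreover have "weighted_sum (\<lambda>i. A [^] i) f = \<zero>"
        using f that by (simp add: right_null_ideal_def)
      ultimately show ?thesis
        using f pow[OF that] by (simp add: right_null_ideal_def weighted_sum_add)
    qed
    then show ?thesis
      using f by (simp add: right_null_ideal_def)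
  qed
qed

lemma right_null_ideal_finsum:
  assumes "S \<subseteq> carrier R" "finite I" "F \<in> I \<rightarrow> right_null_ideal S"
  shows "(\<Oplus>\<^bsub>P\<^esub>i\<in>I. F i) \<in> right_null_ideal S"
  using assms(2,3)
proof (induction rule: finite_induct)
  interpret N: subgroup "right_null_ideal S" "add_monoid P"
    by (rule subgroup_right_null_ideal) fact
  case empty
  then show ?case using N.one_closed by simp
next
  interpret N: subgroup "right_null_ideal S" "add_monoid P"
    by (rule subgroup_right_null_ideal) fact
  case (insert i I)
  then have "F i \<in> right_null_ideal S" "F \<in> I \<rightarrow> right_null_ideal S"
    by auto
  moreover from this have "F i \<in> carrier P" "F \<in> I \<rightarrow> carrier P"
    by (auto simp: right_null_ideal_def)
  ultimately show ?case
    using insert N.m_closed by simp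
qed

text \<open>The value of \<open>c x^n f\<close> at \<open>A\<close> is \<open>c f(A) A^n\<close>,
  because powers of \<open>A\<close> commute with each other; \<open>g f\<close> is a sum of such
  multiples of \<open>f\<close>.\<close>

lemma right_null_ideal_left:
  assumes S: "S \<subseteq> carrier R" and f: "f \<in> right_null_ideal S" and g: "g \<in> carrier P"
  shows "g \<otimes>\<^bsub>P\<^esub> f \<in> right_null_ideal S"
proof -
  have fP: "f \<in> carrier P"
    using f by (simp add: right_null_ideal_def)
  have monom: "up_ring.monom P c n \<otimes>\<^bsub>P\<^esub> f \<in> right_null_ideal S" if c: "c \<in> carrier R" for c n
  proof -
    have "weighted_sum (\<lambda>i. A [^] i) (up_ring.monom P c n \<otimes>\<^bsub>P\<^esub> f) = \<zero>" if A: "A \<in> S" for A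
    proof -
      have [simp]: "A \<in> carrier R"
        using S A by auto
      have "weighted_sum (\<lambda>i. A [^] i) (up_ring.monom P c n \<otimes>\<^bsub>P\<^esub> f)
          = (\<Oplus>i\<in>{..deg R f}. c \<otimes> up_ring.coeff P f i \<otimes> A [^] (n + i))"
        using fP c by (intro weighted_sum_monom_mult) auto
      also have "\<dots> = (\<Oplus>i\<in>{..deg R f}. c \<otimes> (up_ring.coeff P f i \<otimes> A [^] i) \<otimes> A [^] n)"
        using fP c
        by (intro R.finsum_cong') (auto simp: R.m_assoc R.nat_pow_mult add.commute)
      also have "\<dots> = (\<Oplus>i\<in>{..deg R f}. c \<otimes> (up_ring.coeff P f i \<otimes> A [^] i)) \<otimes> A [^] n"
        using fP c by (intro R.finsum_ldistr[symmetric]) auto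
      also have "\<dots> = c \<otimes> weighted_sum (\<lambda>i. A [^] i) f \<otimes> A [^] n"
        unfolding weighted_sum_def using fP c by (subst R.finsum_rdistr) auto
      also have "\<dots> = \<zero>"
        using f A c by (simp add: right_null_ideal_def)
      finally show ?thesis .
    qed
    then show ?thesis
      using fP c by (simp add: right_null_ideal_def)
  qed
  have "g \<otimes>\<^bsub>P\<^esub> f = (\<Oplus>\<^bsub>P\<^esub>i\<in>{..deg R g}. up_ring.monom P (up_ring.coeff P g i) i) \<otimes>\<^bsub>P\<^esub> f"
    using g by (simp add: up_repr)
  also have "\<dots> = (\<Oplus>\<^bsub>P\<^esub>i\<in>{..deg R g}. up_ring.monom P (up_ring.coeff P g i) i \<otimes>\<^bsub>P\<^esub> f)"
    using g fP by (intro P.finsum_ldistr) auto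
  also have "\<dots> \<in> right_null_ideal S"
    using S g monom by (intro right_null_ideal_finsum) auto
  finally show ?thesis .
qed

text \<open>
  The weights \<open>u\<close>, \<open>v\<close> do not depend on \<open>A\<close>: they record the remainder \<open>u i + v i x\<close> of \<open>x\<^sup>i\<close> modulo
  a monic central polynomial of degree at most two that vanishes on \<open>S\<close>. The last assumption says
  that the remainder of every \<open>f\<close> in the null ideal is zero, and for central weights this property is
  stable under multiplying the coefficients of \<open>f\<close> by a constant on the right.
\<close>

lemma right_null_ideal_right:
  assumes S: "S \<subseteq> carrier R"
    and u: "\<And>i. central (u i)" and v: "\<And>i. central (v i)"
    and pow: "\<And>A i. A \<in> S \<Longrightarrow> A [^] (i::nat) = u i \<oplus> v i \<otimes> A"
    and null: "\<And>f. f \<in> right_null_ideal S \<Longrightarrow> weighted_sum u f = \<zero> \<and> weighted_sum v f = \<zero>"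
    and f: "f \<in> right_null_ideal S" and g: "g \<in> carrier P"
  shows "f \<otimes>\<^bsub>P\<^esub> g \<in> right_null_ideal S"
proof -
  have fP: "f \<in> carrier P"
    using f by (simp add: right_null_ideal_def)
  note [simp] = central_closed[OF u] central_closed[OF v]
  have monom: "f \<otimes>\<^bsub>P\<^esub> up_ring.monom P c n \<in> right_null_ideal S" if c: "c \<in> carrier R" for c n
  proof -
    have "weighted_sum (\<lambda>i. A [^] i) (f \<otimes>\<^bsub>P\<^esub> up_ring.monom P c n) = \<zero>" if A: "A \<in> S" for A
    proof -
      have [simp]: "A \<in> carrier R"
        using S A by auto
      have comm: "c \<otimes> u i = u i \<otimes> c" "c \<otimes> v i = v i \<otimes> c" for i
        using u v c unfolding central_def by metis+
      have "c \<otimes> (u i \<otimes> x) = u i \<otimes> (c \<otimes> x)" "c \<otimes> (v i \<otimes> x) = v i \<otimes> (c \<otimes> x)"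
        if "x \<in> carrier R" for x i
        using c that comm[of i] by (simp_all add: R.m_assoc[symmetric])
      \<comment> \<open>Once \<open>c\<close> is moved past the central weights, the right-hand
        factors \<open>c A^n\<close> and \<open>c A A^n\<close> do not depend on \<open>i\<close>,
        so the sum factors through the two remainder coefficients of \<open>f\<close>.\<close>
      then have split: "up_ring.coeff P f i \<otimes> c \<otimes> A [^] (i + n)
          = (up_ring.coeff P f i \<otimes> u i) \<otimes> (c \<otimes> A [^] n)
            \<oplus> (up_ring.coeff P f i \<otimes> v i) \<otimes> (c \<otimes> (A \<otimes> A [^] n))" for i
        using fP c
        by (simp add: R.nat_pow_mult[symmetric] pow[OF A, of i] R.r_distr R.l_distr R.m_assoc)
      have "weighted_sum (\<lambda>i. A [^] i) (f \<otimes>\<^bsub>P\<^esub> up_ring.monom P c n)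
          = (\<Oplus>i\<in>{..deg R f}. up_ring.coeff P f i \<otimes> c \<otimes> A [^] (i + n))"
        using fP c by (intro weighted_sum_mult_monom) auto
      also have "\<dots> = weighted_sum u f \<otimes> (c \<otimes> A [^] n) \<oplus> weighted_sum v f \<otimes> (c \<otimes> (A \<otimes> A [^] n))"
        using fP c unfolding weighted_sum_def split
        by (subst R.finsum_addf, simp, simp, subst (1 2) R.finsum_ldistr) auto
      also have "\<dots> = \<zero>"
        using null[OF f] c by simp
      finally show ?thesis .
    qed
    then show ?thesis
      using fP c by (simp add: right_null_ideal_def)
  qed
  have "f \<otimes>\<^bsub>P\<^esub> g = f \<otimes>\<^bsub>P\<^esub> (\<Oplus>\<^bsub>P\<^esub>i\<in>{..deg R g}. up_ring.monom P (up_ring.coeff P g i) i)"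
    using g by (simp add: up_repr)
  also have "\<dots> = (\<Oplus>\<^bsub>P\<^esub>i\<in>{..deg R g}. f \<otimes>\<^bsub>P\<^esub> up_ring.monom P (up_ring.coeff P g i) i)"
    using g fP by (intro P.finsum_rdistr) auto
  also have "\<dots> \<in> right_null_ideal S"
    using S g monom by (intro right_null_ideal_finsum) auto
  finally show ?thesis .
qed

lemma ideal_right_null_ideal:
  assumes "S \<subseteq> carrier R"
    and "\<And>i. central (u i)" and "\<And>i. central (v i)"
    and "\<And>A i. A \<in> S \<Longrightarrow> A [^] (i::nat) = u i \<oplus> v i \<otimes> A"
    and "\<And>f. f \<in> right_null_ideal S \<Longrightarrow> weighted_sum u f = \<zero> \<and> weighted_sum v f = \<zero>"
  shows "ideal (right_null_ideal S) P"
  using assms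
  by (intro idealI P.ring_axioms subgroup_right_null_ideal)
    (auto intro: right_null_ideal_left right_null_ideal_right[of S u v])

lemma ideal_right_null_ideal_empty: "ideal (right_null_ideal {}) P"
  using P.oneideal by (simp add: right_null_ideal_def)

text \<open>This is reduction modulo \<open>x - A\<close>: the weights \<open>u i = A^i\<close> and
  \<open>v i = 0\<close> are central, and vanishing of \<open>weighted_sum u f\<close> is membership
  in the null ideal itself.\<close>

lemma ideal_right_null_ideal_central:
  assumes "central A"
  shows "ideal (right_null_ideal {A}) P"
  using assms
  by (intro ideal_right_null_ideal[of _ "\<lambda>i. A [^] i" "\<lambda>_. \<zero>"])
    (auto simp: central_pow central_zero right_null_ideal_def weighted_sum_def R.finsum_zero)

text \<open>Reduction modulo the central quadratic \<open>x^2 - t x - e\<close> gives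
  \<open>f(C) = U + V C\<close> with the same \<open>U\<close> and \<open>V\<close> for every
  \<open>C \<in> S\<close>. If \<open>f\<close> vanishes on \<open>S\<close>, comparing
  \<open>A\<close> and \<open>B\<close> yields \<open>V A = V B\<close>, so \<open>cancel\<close>
  kills \<open>V\<close> and then \<open>U\<close> vanishes too.\<close>

lemma ideal_right_null_ideal_quadratic:
  assumes S: "S \<subseteq> carrier R"
    and t: "central t" and e: "central e"
    and quad: "\<And>A. A \<in> S \<Longrightarrow> A \<otimes> A = t \<otimes> A \<oplus> e"
    and AB: "A \<in> S" "B \<in> S"
    and cancel: "\<And>X. X \<in> carrier R \<Longrightarrow> X \<otimes> A = X \<otimes> B \<Longrightarrow> X = \<zero>"
  shows "ideal (right_null_ideal S) P"
proof -
  \<comment> \<open>Multiplying \<open>u + v x\<close> by \<open>x\<close> and replacing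
    \<open>x^2\<close> by \<open>t x + e\<close> gives \<open>v e + (u + v t) x\<close>.\<close>
  define uv where "uv = rec_nat (\<one>, \<zero>) (\<lambda>_ (x, y). (y \<otimes> e, x \<oplus> y \<otimes> t))"
  define u where "u i = fst (uv i)" for i
  define v where "v i = snd (uv i)" for i
  have base: "u 0 = \<one>" "v 0 = \<zero>"
    by (simp_all add: u_def v_def uv_def)
  have step: "u (Suc i) = v i \<otimes> e" "v (Suc i) = u i \<oplus> v i \<otimes> t" for i
    by (simp_all add: u_def v_def uv_def case_prod_beta)
  have uv: "central (u i) \<and> central (v i)" for i
    by (induction i) (auto simp: base step central_zero central_one central_mult central_add t e)
  then have u: "central (u i)" and v: "central (v i)" for i
    by auto
  note [simp] = central_closed[OF u] central_closed[OF v] central_closed[OF t] central_closed[OF e]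
  have pow: "C [^] (i::nat) = u i \<oplus> v i \<otimes> C" if C: "C \<in> S" for C i
  proof (induction i)
    case 0
    then show ?case using S C by (auto simp: base)
  next
    case (Suc i)
    have [simp]: "C \<in> carrier R" using S C by auto
    have "C [^] Suc i = (u i \<oplus> v i \<otimes> C) \<otimes> C"
      using Suc by simp
    also have "\<dots> = u i \<otimes> C \<oplus> v i \<otimes> (t \<otimes> C \<oplus> e)"
      by (simp add: R.l_distr R.m_assoc quad[OF C])
    also have "\<dots> = u (Suc i) \<oplus> v (Suc i) \<otimes> C"
      by (simp add: step R.l_distr R.r_distr R.m_assoc R.a_ac)
    finally show ?case .
  qed
  have "weighted_sum u f = \<zero> \<and> weighted_sum v f = \<zero>" if f: "f \<in> right_null_ideal S" for f
  proof -
    have fP: "f \<in> carrier P"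
      using f by (simp add: right_null_ideal_def)
    have AB': "A \<in> carrier R" "B \<in> carrier R"
      using S AB by auto
    have [simp]: "weighted_sum u f \<in> carrier R" "weighted_sum v f \<in> carrier R"
      using fP by auto
    have eval: "weighted_sum u f \<oplus> weighted_sum v f \<otimes> C = \<zero>" if C: "C \<in> S" for C
    proof -
      have [simp]: "C \<in> carrier R" using S C by auto
      have "\<zero> = weighted_sum (\<lambda>i. C [^] i) f"
        using f C by (simp add: right_null_ideal_def)
      also have "\<dots> = weighted_sum u f \<oplus> weighted_sum v f \<otimes> C"
      proof -
        have "(\<Oplus>i\<in>{..deg R f}. up_ring.coeff P f i \<otimes> C [^] i)
            = (\<Oplus>i\<in>{..deg R f}. up_ring.coeff P f i \<otimes> u i \<oplus> up_ring.coeff P f i \<otimes> v i \<otimes> C)"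
          using fP by (intro R.finsum_cong') (auto simp: pow[OF C] R.r_distr R.m_assoc)
        then show ?thesis
          using fP unfolding weighted_sum_def
          by (simp add: R.finsum_addf R.finsum_ldistr)
      qed
      finally show ?thesis by simp
    qed
    have "weighted_sum u f \<oplus> weighted_sum v f \<otimes> A = weighted_sum u f \<oplus> weighted_sum v f \<otimes> B"
      using eval AB by simp
    then have "weighted_sum v f \<otimes> A = weighted_sum v f \<otimes> B"
      using AB' by (simp add: R.add.m_ac)
    then have "weighted_sum v f = \<zero>"
      by (intro cancel) auto
    with eval[OF AB(1)] AB' show ?thesis
      by simp
  qed
  then show ?thesis
    using S u v pow by (intro ideal_right_null_ideal[of S u v])
qed

text \<open>If the null ideal of \<open>{A}\<close> is two-sided, it contains \<open>(x - A) B\<close>, whose value at \<open>A\<close> is \<open>B A - A B\<close>.\<close>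

lemma central_if_ideal_right_null_ideal:
  assumes A: "A \<in> carrier R" and ideal: "ideal (right_null_ideal {A}) P"
  shows "central A"
proof -
  have pow: "(\<lambda>i. A [^] (i::nat)) \<in> UNIV \<rightarrow> carrier R"
    using A by auto
  define f where "f = up_ring.monom P \<one> 1 \<oplus>\<^bsub>P\<^esub> up_ring.monom P (\<ominus> A) 0"
  have fP: "f \<in> carrier P"
    unfolding f_def using A by (intro P.a_closed monom_closed) auto
  have f: "f \<in> right_null_ideal {A}"
  proof -
    have "weighted_sum (\<lambda>i. A [^] i) f = \<one> \<otimes> A [^] (1::nat) \<oplus> \<ominus> A \<otimes> A [^] (0::nat)"
      unfolding f_def using A pow by (subst weighted_sum_add) (auto simp: weighted_sum_monom simp del: monom_a_inv)
    also have "\<dots> = \<zero>"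
      using A by (simp add: R.r_neg)
    finally show ?thesis
      using fP by (simp add: right_null_ideal_def)
  qed
  have "B \<otimes> A = A \<otimes> B" if B: "B \<in> carrier R" for B
  proof -
    have "f \<otimes>\<^bsub>P\<^esub> up_ring.monom P B 0 \<in> right_null_ideal {A}"
      using B f by (intro ideal.I_r_closed[OF ideal]) auto
    moreover have "f \<otimes>\<^bsub>P\<^esub> up_ring.monom P B 0 = up_ring.monom P B 1 \<oplus>\<^bsub>P\<^esub> up_ring.monom P (\<ominus> A \<otimes> B) 0"
      using A B monom_mult[of \<one> B 1 0] monom_mult[of "\<ominus> A" B 0 0]
      by (simp add: f_def P.l_distr del: One_nat_def monom_mult monom_a_inv)
    ultimately have "B \<otimes> A \<oplus> \<ominus> A \<otimes> B = \<zero>"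
      using A B pow
      by (simp add: right_null_ideal_def weighted_sum_add weighted_sum_monom del: One_nat_def monom_mult monom_a_inv)
    then show ?thesis
      using A B R.minus_equality[of "B \<otimes> A" "\<ominus> A \<otimes> B"] by (simp add: R.l_minus)
  qed
  then show ?thesis
    using A unfolding central_def by metis
qed

end

section \<open>Specialization to matrices and arithmetic in their entries\<close>

interpretation M2P: UP_ring "M2 :: 'a::field mat ring" "M2x"
  by (simp add: UP_ring_def ring_mat)

text \<open>The coefficient map in \<open>reval\<close> is the identity, so \<open>reval\<close> is
  the weighted sum with the powers of \<open>A\<close> as weights.\<close>

lemma core_iff_ideal:
  fixes S :: "'a::field mat set"
  shows "core S \<longleftrightarrow> ideal (M2P.right_null_ideal S) M2x"
proof -
  have "reval f A = M2P.weighted_sum (\<lambda>i. A [^]\<^bsub>M2\<^esub> i) f" if "f \<in> carrier M2x"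
    for f and A :: "'a mat"
    using that by (simp add: reval_def eval_def M2P.weighted_sum_def)
  then have "null_ideal S = M2P.right_null_ideal S"
    unfolding null_ideal_def M2P.right_null_ideal_def by auto
  then show ?thesis
    by (simp add: core_def)
qed

definition mat2 :: "'a \<Rightarrow> 'a \<Rightarrow> 'a \<Rightarrow> 'a \<Rightarrow> 'a::field mat" where
  "mat2 a b c e = mat 2 2 (\<lambda>(i, j). if i = 0 then if j = 0 then a else b else if j = 0 then c else e)"

lemma mat2_carrier [simp]: "mat2 a b c e \<in> carrier_mat 2 2"
  by (simp add: mat2_def)

lemma mat2_eq_iff: "mat2 a b c e = mat2 a' b' c' e' \<longleftrightarrow> a = a' \<and> b = b' \<and> c = c' \<and> e = e'"
proof
  assume eq: "mat2 a b c e = mat2 a' b' c' e'"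
  have "mat2 a b c e $$ (i, j) = mat2 a' b' c' e' $$ (i, j)" for i j
    by (simp add: eq)
  from this[of 0 0] this[of 0 1] this[of 1 0] this[of 1 1]
  show "a = a' \<and> b = b' \<and> c = c' \<and> e = e'"
    by (simp add: mat2_def)
qed simp

lemma mat2_cases:
  assumes "A \<in> carrier_mat 2 2"
  obtains a b c e where "A = mat2 a b c e"
proof
  show "A = mat2 (A $$ (0, 0)) (A $$ (0, 1)) (A $$ (1, 0)) (A $$ (1, 1))"
    using assms by (intro eq_matI) (auto simp: mat2_def less_2_cases_iff)
qed

lemma mat2_add: "mat2 a b c e + mat2 a' b' c' e' = mat2 (a + a') (b + b') (c + c') (e + e')"
  by (intro eq_matI) (auto simp: mat2_def)

lemma mat2_smult: "k \<cdot>\<^sub>m mat2 a b c e = mat2 (k * a) (k * b) (k * c) (k * e)"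
  by (intro eq_matI) (auto simp: mat2_def)

lemma mat2_mult:
  "mat2 a b c e * mat2 a' b' c' e' = mat2 (a * a' + b * c') (a * b' + b * e') (c * a' + e * c') (c * b' + e * e')"
  by (intro eq_matI) (auto simp: mat2_def scalar_prod_def numeral_2_eq_2)

lemma mat2_zero: "0\<^sub>m 2 2 = mat2 0 0 0 0"
  by (intro eq_matI) (auto simp: mat2_def)

lemma mat2_one: "1\<^sub>m 2 = mat2 1 0 0 1"
  by (intro eq_matI) (auto simp: mat2_def less_2_cases_iff)

lemmas mat2_simps = mat2_add mat2_smult mat2_mult mat2_zero mat2_one mat2_eq_iff

lemma central_mat2_iff: "M2P.central (mat2 a b c e) \<longleftrightarrow> b = 0 \<and> c = 0 \<and> a = e"
proof
  assume central: "M2P.central (mat2 a b c e)"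
  have "mat2 a b c e * X = X * mat2 a b c e" if "X \<in> carrier_mat 2 2" for X
    using central that by (simp add: M2P.central_def ring_mat_simps)
  \<comment> \<open>Commuting with the first matrix unit kills the off-diagonal entries; commuting
    with the second equates the diagonal ones.\<close>
  from this[of "mat2 1 0 0 0"] this[of "mat2 0 1 0 0"]
  show "b = 0 \<and> c = 0 \<and> a = e"
    by (simp add: mat2_simps)
next
  assume "b = 0 \<and> c = 0 \<and> a = e"
  then have "mat2 a b c e * X = X * mat2 a b c e" if "X \<in> carrier_mat 2 2" for X
    using that by (elim mat2_cases) (auto simp: mat2_simps)
  then show "M2P.central (mat2 a b c e)"
    by (simp add: M2P.central_def ring_mat_simps)
qed

text \<open>Degree at most two suffices, since minimality of \<open>m\<close> only involves
  \<open>m\<close> and polynomials of smaller degree, whose missing coefficients are zero.\<close>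

lemma poly_at_mat2:
  assumes "degree p \<le> 2"
  defines "p0 \<equiv> poly.coeff p 0" and "p1 \<equiv> poly.coeff p 1" and "p2 \<equiv> poly.coeff p 2"
  shows "poly_at_mat p (mat2 a b c e) =
    mat2 (p0 + p1 * a + p2 * (a * a + b * c)) (p1 * b + p2 * (a * b + b * e))
      (p1 * c + p2 * (c * a + e * c)) (p0 + p1 * e + p2 * (c * b + e * e))"
proof -
  let ?A = "mat2 a b c e"
  define t where "t i = poly.coeff p i \<cdot>\<^sub>m (?A [^]\<^bsub>M2\<^esub> i)" for i :: nat
  have pow: "?A [^]\<^bsub>M2\<^esub> i \<in> carrier M2" for i :: nat
    by (intro M2P.R.nat_pow_closed) (simp add: ring_mat_simps)
  then have t: "t i \<in> carrier M2" for i
    by (simp add: ring_mat_simps t_def)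
  have zero: "t i = \<zero>\<^bsub>M2\<^esub>" if "i > degree p" for i
    using pow[of i] that by (auto simp: coeff_eq_0 ring_mat_simps t_def)
  have "poly_at_mat p ?A = (\<Oplus>\<^bsub>M2\<^esub>i\<in>{..2}. t i)"
    unfolding poly_at_mat_def t_def[symmetric] using assms t zero
    by (intro M2P.R.add.finprod_mono_neutral_cong_left) auto
  also have "{..2} = {0, 1, 2::nat}"
    by auto
  also have "(\<Oplus>\<^bsub>M2\<^esub>i\<in>{0, 1, 2}. t i) = t 0 \<oplus>\<^bsub>M2\<^esub> (t 1 \<oplus>\<^bsub>M2\<^esub> t 2)"
    using t by simp
  finally have "poly_at_mat p ?A = t 0 + (t 1 + t 2)"
    by (simp add: ring_mat_simps)
  moreover have "?A [^]\<^bsub>M2\<^esub> (0::nat) = mat2 1 0 0 1" "?A [^]\<^bsub>M2\<^esub> (1::nat) = ?A"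
    "?A [^]\<^bsub>M2\<^esub> (2::nat) = ?A * ?A"
    using M2P.R.nat_pow_Suc[of ?A 1, unfolded Suc_1] by (simp_all add: ring_mat_simps mat2_simps)
  ultimately show ?thesis
    by (simp add: mat2_simps t_def p0_def p1_def p2_def algebra_simps)
qed

section \<open>The class of a linear polynomial\<close>

text \<open>For \<open>m = x - r\<close> the only zero is the scalar matrix of \<open>r\<close>, and
  no nonzero constant vanishes at a matrix.\<close>

lemma min_poly_class_linear:
  assumes "lead_coeff m = 1" "degree m = 1"
  defines "r \<equiv> - poly.coeff m 0"
  shows "min_poly_class m = {mat2 r 0 0 r}"
proof (intro equalityI subsetI)
  have coeffs: "poly.coeff m 0 = - r" "poly.coeff m (Suc 0) = 1" "poly.coeff m 2 = 0"
    using assms by (simp_all add: coeff_eq_0)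
  show "A \<in> {mat2 r 0 0 r}" if "A \<in> min_poly_class m" for A
  proof -
    have A: "A \<in> carrier_mat 2 2" "poly_at_mat m A = 0\<^sub>m 2 2"
      using that by (auto simp: min_poly_class_def is_min_poly_def ring_mat_simps)
    obtain a b c e where "A = mat2 a b c e"
      using A(1) by (rule mat2_cases)
    with A(2) show ?thesis
      using assms(2) by (simp add: poly_at_mat2 coeffs mat2_simps)
  qed
  show "A \<in> min_poly_class m" if "A \<in> {mat2 r 0 0 r}" for A
  proof -
    have "degree f \<ge> 1" if f: "f \<noteq> 0" "poly_at_mat f (mat2 r 0 0 r) = 0\<^sub>m 2 2" for f
    proof (rule ccontr)
      assume "\<not> degree f \<ge> 1"
      then have "degree f = 0" by simp
      then show False
        using f by (auto simp: poly_at_mat2 mat2_simps coeff_eq_0 elim!: degree_eq_zeroE)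
    qed
    then show ?thesis
      using that assms(1,2)
      by (auto simp: min_poly_class_def is_min_poly_def ring_mat_simps poly_at_mat2 coeffs mat2_simps)
  qed
qed

section \<open>The class of an irreducible quadratic\<close>

locale irreducible_quadratic =
  fixes m :: "'a::field poly"
  assumes monic: "lead_coeff m = 1" and irreducible: "irreducible m" and degree: "degree m = 2"
begin

lemma poly_eq: "poly m x = poly.coeff m 0 + poly.coeff m 1 * x + x * x"
  using monic degree by (simp add: poly_altdef numeral_2_eq_2)

text \<open>A root would split off a linear factor with a unit as cofactor, so \<open>m\<close>
  would be linear.\<close>

lemma poly_neq_zero: "poly m x \<noteq> 0"
proof
  assume "poly m x = 0"
  then obtain k where k: "m = [:- x, 1:] * k"
    by (auto simp: poly_eq_0_iff_dvd elim: dvdE)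
  then have "[:- x, 1:] dvd 1 \<or> k dvd 1"
    using irreducible by (intro irreducibleD) auto
  then have "k dvd 1"
    by (auto simp: is_unit_iff_degree)
  have "k \<noteq> 0"
    using k degree by auto
  with \<open>k dvd 1\<close> have "degree k = 0"
    by (simp add: is_unit_iff_degree)
  moreover have "degree m = 1 + degree k"
    unfolding k using \<open>k \<noteq> 0\<close> by (subst degree_mult_eq) auto
  ultimately show False
    using degree by simp
qed

text \<open>The last two conditions prescribe trace and determinant as read off from
  \<open>m\<close>. If \<open>b\<close> were zero, \<open>a\<close> would be a root of
  \<open>m\<close>; \<open>b \<noteq> 0\<close> also excludes nonzero annihilating polynomials of
  degree below two.\<close>

lemma mat2_in_class_iff:
  "mat2 a b c e \<in> min_poly_class m \<longleftrightarrow>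
    b \<noteq> 0 \<and> e = - poly.coeff m 1 - a \<and> b * c = - poly m a"
proof -
  have coeff2: "poly.coeff m 2 = 1"
    using monic degree by simp
  have root: "poly_at_mat m (mat2 a b c e) = 0\<^sub>m 2 2 \<longleftrightarrow>
      b \<noteq> 0 \<and> e = - poly.coeff m 1 - a \<and> b * c = - poly m a" (is "?L \<longleftrightarrow> ?R")
  proof
    assume ?L
    then have L: "poly.coeff m 0 + poly.coeff m 1 * a + (a * a + b * c) = 0"
        "poly.coeff m 1 * b + (a * b + b * e) = 0"
      using degree by (simp_all add: poly_at_mat2 coeff2 mat2_simps)
    have "b * c = - poly m a"
      using L(1) by (simp add: poly_eq eq_neg_iff_add_eq_0 algebra_simps)
    moreover from this have "b \<noteq> 0"
      using poly_neq_zero[of a] by auto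
    moreover have "b * (e - (- poly.coeff m 1 - a)) = 0"
      using L(2) by (simp add: algebra_simps)
    ultimately show ?R
      unfolding mult_eq_0_iff right_minus_eq by blast
  next
    assume ?R
    then have e: "e = - poly.coeff m 1 - a" and bc: "b * c = - poly m a" "c * b = - poly m a"
      by (auto simp: mult.commute)
    show ?L
      using degree
      by (simp add: poly_at_mat2 coeff2 mat2_simps bc poly_eq) (simp add: e algebra_simps)
  qed
  have "degree m \<le> degree f"
    if b: "b \<noteq> 0" and f: "f \<noteq> 0" "poly_at_mat f (mat2 a b c e) = 0\<^sub>m 2 2" for f
  proof (rule ccontr)
    assume "\<not> degree m \<le> degree f"
    then have f1: "degree f \<le> 1"
      using degree by simp
    then have "poly.coeff f 2 = 0"
      by (intro coeff_eq_0) simp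
    \<comment> \<open>The upper right entry of the value of \<open>f\<close> is
      \<open>poly.coeff f 1 * b\<close>, which kills the linear coefficient; the diagonal then kills
      the constant one.\<close>
    then have zero: "poly.coeff f 1 = 0" "poly.coeff f 0 = 0"
      using f f1 b by (auto simp: poly_at_mat2 mat2_simps)
    have "lead_coeff f = 0"
      using f1 zero by (cases "degree f") auto
    then show False
      using f by simp
  qed
  then show ?thesis
    using root monic by (auto simp: min_poly_class_def is_min_poly_def ring_mat_simps)
qed

lemma class_eq_image:
  "min_poly_class m =
    (\<lambda>(a, b). mat2 a b (- poly m a / b) (- poly.coeff m 1 - a)) ` (UNIV \<times> (UNIV - {0}))"
proof (intro equalityI subsetI)
  fix A assume A: "A \<in> min_poly_class m"
  then have "A \<in> carrier_mat 2 2"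
    by (simp add: min_poly_class_def ring_mat_simps)
  then obtain a b c e where abce: "A = mat2 a b c e"
    by (rule mat2_cases)
  with A have "b \<noteq> 0" "e = - poly.coeff m 1 - a" "c * b = - poly m a"
    by (simp_all add: mat2_in_class_iff mult.commute)
  moreover from this have "c = - poly m a / b"
    by (metis nonzero_eq_divide_eq)
  ultimately show "A \<in> (\<lambda>(a, b). mat2 a b (- poly m a / b) (- poly.coeff m 1 - a)) ` (UNIV \<times> (UNIV - {0}))"
    by (intro image_eqI[of _ _ "(a, b)"]) (auto simp: abce)
qed (auto simp: mat2_in_class_iff split: if_splits)

text \<open>The top row \<open>(a, b)\<close> determines the matrix: \<open>q\<close> choices for
  \<open>a\<close> and \<open>q - 1\<close> for \<open>b\<close>.\<close>

lemma card_class: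
  assumes "finite (UNIV :: 'a set)"
  shows "card (min_poly_class m) = CARD('a)\<^sup>2 - CARD('a)"
proof -
  have "inj_on (\<lambda>(a, b). mat2 a b (- poly m a / b) (- poly.coeff m 1 - a)) (UNIV \<times> (UNIV - {0}))"
    by (auto simp: inj_on_def mat2_eq_iff)
  then have "card (min_poly_class m) = card ((UNIV :: 'a set) \<times> (UNIV - {0 :: 'a}))"
    unfolding class_eq_image by (rule card_image)
  also have "\<dots> = CARD('a) * (CARD('a) - 1)"
    using assms by (simp add: card_cartesian_product card_Diff_singleton)
  finally show ?thesis
    by (simp add: power2_eq_square diff_mult_distrib2)
qed

text \<open>
  Up to the nonzero factor \<open>b b'\<close>, the determinant of the difference of two elements of the class is
  a value of the homogenization \<open>y\<^sup>2 m(x / y)\<close>, which is anisotropic.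
\<close>

lemma det_difference_neq_zero:
  assumes A: "mat2 a b c e \<in> min_poly_class m" and B: "mat2 a' b' c' e' \<in> min_poly_class m"
    and neq: "mat2 a b c e \<noteq> mat2 a' b' c' e'"
  shows "(a - a') * (a - a') + (b - b') * (c - c') \<noteq> 0"
proof
  assume det: "(a - a') * (a - a') + (b - b') * (c - c') = 0"
  have A': "b \<noteq> 0" "e = - poly.coeff m 1 - a" "b * c = - poly m a"
    and B': "b' \<noteq> 0" "e' = - poly.coeff m 1 - a'" "b' * c' = - poly m a'"
    using A B by (simp_all add: mat2_in_class_iff)
  show False
  proof (cases "b = b'")
    case True
    with det have "a = a'" by simp
    moreover from this have "b' * c = b' * c'"
      using A'(3) B'(3) True by simp
    then have "c = c'"
      using B'(1) by simp
    ultimately show False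
      using A' B' True neq by simp
  next
    case False
    \<comment> \<open>With zero determinant, \<open>A - B\<close> kills the column
      \<open>w = (b - b', -(a - a'))\<close>, and \<open>A w = B w\<close> has first entry
      \<open>x\<close>. As \<open>A \<noteq> B\<close>, \<open>w\<close> would be an eigenvector,
      with eigenvalue \<open>x / y\<close> a root of \<open>m\<close>.\<close>
    define x where "x = b * a' - b' * a"
    define y where "y = b - b'"
    have y: "y \<noteq> 0"
      using False by (simp add: y_def)
    have "y * y * poly m (x / y) = poly.coeff m 0 * (y * y) + poly.coeff m 1 * x * y + x * x"
      using y by (simp add: poly_eq field_simps)
    also have "\<dots> = b * b' * ((a - a') * (a - a') + (b - b') * (c - c'))"
    proof -
      \<comment> \<open>In this form \<open>c\<close> and \<open>c'\<close> occur only in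
        \<open>b * c\<close> and \<open>b' * c'\<close>, which can be replaced by values of
        \<open>m\<close>.\<close>
      have "b * b' * ((a - a') * (a - a') + (b - b') * (c - c'))
          = b * b' * ((a - a') * (a - a')) + (b - b') * (b' * (b * c) - b * (b' * c'))"
        by (simp add: algebra_simps)
      also have "\<dots> = poly.coeff m 0 * (y * y) + poly.coeff m 1 * x * y + x * x"
        unfolding A'(3) B'(3) poly_eq x_def y_def by (simp add: algebra_simps)
      finally show ?thesis by simp
    qed
    finally show False
      using det y poly_neq_zero by simp
  qed
qed

text \<open>The difference \<open>A - B\<close> is invertible: its determinant is, up to sign, the
  quantity in \<open>det_difference_neq_zero\<close>.\<close>

lemma mat2_cancel:
  assumes A: "A \<in> min_poly_class m" and B: "B \<in> min_poly_class m" and neq: "A \<noteq> B"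
    and X: "X \<in> carrier_mat 2 2" and eq: "X * A = X * B"
  shows "X = 0\<^sub>m 2 2"
proof -
  have "A \<in> carrier_mat 2 2" "B \<in> carrier_mat 2 2"
    using A B by (simp_all add: min_poly_class_def ring_mat_simps)
  then obtain a b c e a' b' c' e' where AB: "A = mat2 a b c e" "B = mat2 a' b' c' e'"
    by (elim mat2_cases)
  obtain x y z w where X: "X = mat2 x y z w"
    using X by (rule mat2_cases)
  let ?D = "(a - a') * (a - a') + (b - b') * (c - c')"
  have D: "?D \<noteq> 0"
    using A B neq det_difference_neq_zero by (simp add: AB)
  have e: "e = - poly.coeff m 1 - a" "e' = - poly.coeff m 1 - a'"
    using A B by (simp_all add: AB mat2_in_class_iff)
  have row: "x = 0 \<and> y = 0"
    if "x * a + y * c = x * a' + y * c'" "x * b + y * e = x * b' + y * e'" for x y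
  proof -
    have 1: "x * (a - a') + y * (c - c') = 0" and 2: "y * (a - a') - x * (b - b') = 0"
      using that by (simp_all add: e algebra_simps)
    \<comment> \<open>Cramer's rule: up to sign, the multipliers are the entries of the adjugate of
      \<open>A - B\<close>.\<close>
    have "x * ?D = (x * (a - a') + y * (c - c')) * (a - a') - (y * (a - a') - x * (b - b')) * (c - c')"
      by (simp add: algebra_simps)
    moreover have "y * ?D = (y * (a - a') - x * (b - b')) * (a - a') + (x * (a - a') + y * (c - c')) * (b - b')"
      by (simp add: algebra_simps)
    ultimately have "x * ?D = 0" "y * ?D = 0"
      by (simp_all only: 1 2) simp_all
    with D show ?thesis by simp
  qed
  show ?thesis
    using eq row[of x y] row[of z w] by (simp add: AB X mat2_simps)
qed

section \<open>Core and noncore subsets of the quadratic class\<close>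

text \<open>A two-sided null ideal would make \<open>A\<close> central, hence scalar, but its upper
  right entry is nonzero.\<close>

lemma noncore_singleton:
  assumes A: "A \<in> min_poly_class m"
  shows "noncore {A}"
proof
  assume "core {A}"
  have carrier: "A \<in> carrier_mat 2 2"
    using A by (simp add: min_poly_class_def ring_mat_simps)
  with \<open>core {A}\<close> have "M2P.central A"
    by (intro M2P.central_if_ideal_right_null_ideal) (simp_all add: core_iff_ideal ring_mat_simps)
  moreover obtain a b c e where "A = mat2 a b c e"
    using carrier by (rule mat2_cases)
  ultimately show False
    using A by (simp add: central_mat2_iff mat2_in_class_iff)
qed

text \<open>All elements satisfy \<open>C^2 = t C + d\<close>, with \<open>t\<close> the common
  trace and \<open>d\<close> the negated common determinant, taken as scalar matrices;
  \<open>A\<close> and \<open>B\<close> supply the cancellation.\<close>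

lemma core_if_distinct:
  assumes S: "S \<subseteq> min_poly_class m" and AB: "A \<in> S" "B \<in> S" "A \<noteq> B"
  shows "core S"
proof -
  define t where "t = - poly.coeff m 1"
  define d where "d = - poly.coeff m 0"
  have quad: "C * C = mat2 t 0 0 t * C + mat2 d 0 0 d" if C: "C \<in> S" for C
  proof -
    have "C \<in> carrier_mat 2 2"
      using C S by (auto simp: min_poly_class_def ring_mat_simps)
    then obtain a b c e where abce: "C = mat2 a b c e"
      by (rule mat2_cases)
    then have "e = t - a" "b * c = - poly m a" "c * b = - poly m a"
      using C S mat2_in_class_iff[of a b c e] by (auto simp: t_def mult.commute)
    then show ?thesis
      by (simp add: abce mat2_simps poly_eq) (simp add: t_def d_def algebra_simps)
  qed
  have "ideal (M2P.right_null_ideal S) M2x"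
  proof (rule M2P.ideal_right_null_ideal_quadratic)
    show "S \<subseteq> carrier M2"
      using S by (auto simp: min_poly_class_def)
    show "M2P.central (mat2 t 0 0 t)" "M2P.central (mat2 d 0 0 d)"
      by (simp_all add: central_mat2_iff)
    show "C \<otimes>\<^bsub>M2\<^esub> C = mat2 t 0 0 t \<otimes>\<^bsub>M2\<^esub> C \<oplus>\<^bsub>M2\<^esub> mat2 d 0 0 d" if "C \<in> S" for C
      using quad[OF that] by (simp add: ring_mat_simps)
    show "X = \<zero>\<^bsub>M2\<^esub>" if "X \<in> carrier M2" "X \<otimes>\<^bsub>M2\<^esub> A = X \<otimes>\<^bsub>M2\<^esub> B" for X
      using that AB S mat2_cancel[of A B X] by (auto simp: ring_mat_simps)
  qed (use AB in auto)
  then show ?thesis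
    by (simp add: core_iff_ideal)
qed

text \<open>Only singletons remain: the null ideal of the empty set is the whole ring, and two
  distinct elements force \<open>core\<close>.\<close>

lemma noncore_subset_iff:
  assumes "S \<subseteq> min_poly_class m"
  shows "noncore S \<longleftrightarrow> (\<exists>A\<in>min_poly_class m. S = {A})"
proof
  assume "noncore S"
  then have "S \<noteq> {}"
    by (auto simp: core_iff_ideal M2P.ideal_right_null_ideal_empty)
  then obtain A where "A \<in> S" by auto
  then have "S = {A}"
    using \<open>noncore S\<close> core_if_distinct[OF assms] by blast
  with assms show "\<exists>A\<in>min_poly_class m. S = {A}" by auto
qed (auto simp: noncore_singleton)

end

section \<open>Counting the subsets\<close>

theorem theorem1:
  fixes m :: "'a::{field, finite} poly"
  assumes "lead_coeff m = 1" and "irreducible m" and "degree m \<le> 2"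
  shows "(degree m = 1 \<longrightarrow> card {S. S \<subseteq> min_poly_class m \<and> core S} = 2) \<and>
         (degree m = 2 \<longrightarrow>
            card {S. S \<subseteq> min_poly_class m \<and> noncore S} = CARD('a)\<^sup>2 - CARD('a))"
proof (intro conjI impI)
  assume "degree m = 1"
  then obtain r where C: "min_poly_class m = {mat2 r 0 0 r}"
    using assms(1) min_poly_class_linear by blast
  \<comment> \<open>The class consists of one central matrix, so both of its subsets are
    core.\<close>
  have "core S" if "S \<subseteq> min_poly_class m" for S
    using that unfolding C
    by (auto simp: subset_singleton_iff core_iff_ideal central_mat2_iff
        M2P.ideal_right_null_ideal_empty M2P.ideal_right_null_ideal_central)
  then have "{S. S \<subseteq> min_poly_class m \<and> core S} = Pow (min_poly_class m)"
    by auto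
  then show "card {S. S \<subseteq> min_poly_class m \<and> core S} = 2"
    by (simp add: C card_Pow)
next
  assume "degree m = 2"
  then interpret irreducible_quadratic m
    using assms by unfold_locales auto
  have "{S. S \<subseteq> min_poly_class m \<and> noncore S} = (\<lambda>A. {A}) ` min_poly_class m"
    using noncore_subset_iff by auto
  then show "card {S. S \<subseteq> min_poly_class m \<and> noncore S} = CARD('a)\<^sup>2 - CARD('a)"
    using card_class by (simp add: card_image)
qed

end
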